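(* For each diameter diminishing to zero iterated function system $\mathcal{S}=((X,d),(f_i)_{i\in I})$, with attractor $A_{\mathcal{S}}$, we have $$A_{\mathcal{S}}=\overline{\{a_{\dot{\omega}}\mid\omega\in\Lambda^*(I)\smallsetminus\{\lambda\}\}}.$$
   Context: Metric spaces are nonempty. For a metric space $(X,d)$, $P_b(X)$ is the set of nonempty bounded subsets of $X$, $P_{b,cl}(X)$ the set of nonempty bounded closed subsets, and $H_d$ the Hausdorff-Pompeiu metric on $P_{b,cl}(X)$, $H_d(A,B)=\max\{\sup_{x\in A}d(x,B),\sup_{x\in B}d(x,A)\}$, where $d(x,A)=\inf_{y\in A}d(x,y)$. An iterated function system (IFS) is a pair $\mathcal{S}=((X,d),(f_i)_{i\in I})$ where $(X,d)$ is a complete metric space, $I$ is a nonempty finite set, each $f_i:X\to X$ is continuous, and $f_i(B)\in P_b(X)$ for every $B\in P_b(X)$ and $i\in I$. Its fractal operator $F_{\mathcal{S}}:P_{b,cl}(X)\to P_{b,cl}(X)$ is $F_{\mathcal{S}}(B)=\overline{\bigcup_{i\in I}f_i(B)}$; $F_{\mathcal{S}}^{[n]}$ is its $n$-fold composition. $\mathbb{N}^*=\{1,2,\dots\}$. $\Lambda(I)=I^{\mathbb{N}^*}$ is the set of infinite words $\omega=\omega_1\omega_2\dots$ over $I$; $\Lambda_n(I)$ is the set of words of length $n$ over $I$; $\lambda$ is the empty word, $\Lambda_0(I)=\{\lambda\}$, and $\Lambda^*(I)=\bigcup_{n\geq 0}\Lambda_n(I)$ is the set of all finite words. $[\omega]_n=\omega_1\dots\omega_n$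 for $\omega\in\Lambda(I)$. For $\omega=\omega_1\dots\omega_n\in\Lambda_n(I)$ with $n\geq 1$: $f_\omega=f_{\omega_1}\circ\dots\circ f_{\omega_n}$, and $\dot{\omega}=\omega\omega\omega\dots\in\Lambda(I)$ is the infinite periodic word obtained by repeating $\omega$. An IFS $\mathcal{S}$ is diameter diminishing to zero if for every $B\in P_{b,cl}(X)$ there exists $M_B\in P_{b,cl}(X)$ such that $B\subseteq M_B$, $F_{\mathcal{S}}(M_B)\subseteq M_B$ and $\lim_{n\to\infty}\max_{\omega\in\Lambda_n(I)}\mathrm{diam}(f_\omega(M_B))=0$. For a diameter diminishing to zero IFS and $\omega\in\Lambda(I)$, $a_\omega\in X$ denotes the unique point (it exists) such that $\bigcap_{n\in\mathbb{N}^*}\overline{f_{[\omega]_n}(B)}=\{a_\omega\}$ for every $B\in P_{b,cl}(X)$ with $F_{\mathcal{S}}(B)\subseteq B$. The attractor of an IFS $\mathcal{S}$ is the (unique, when it exists) set $A_{\mathcal{S}}\in P_{b,cl}(X)$ with $F_{\mathcal{S}}(A_{\mathcal{S}})=A_{\mathcal{S}}$ and $\lim_{n\to\infty}H_d(F_{\mathcal{S}}^{[n]}(B),A_{\mathcal{S}})=0$ for each $B\in P_{b,cl}(X)$; every diameter diminishing to zero IFS has an attractor. *)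

theory Defs
  imports "HOL-Analysis.Analysis" "HOL-Library.Stream"
begin

definition Pb :: "'a::metric_space set set" where
  "Pb = {B. B \<noteq> {} \<and> bounded B}"

definition Pbcl :: "'a::metric_space set set" where
  "Pbcl = {B. B \<noteq> {} \<and> bounded B \<and> closed B}"

text \<open>The suprema are the intended ones only for nonempty bounded arguments; the function is
  only ever applied to members of \<^const>\<open>Pbcl\<close>.\<close>

definition hausdorff_dist :: "'a::metric_space set \<Rightarrow> 'a set \<Rightarrow> real" where
  "hausdorff_dist A B = max (SUP x\<in>A. infdist x B) (SUP x\<in>B. infdist x A)"

text \<open>The underlying (nonempty, complete) metric space is the type \<open>'a\<close> itself.\<close>

definition IFS :: "'i set \<Rightarrow> ('i \<Rightarrow> 'a::complete_space \<Rightarrow> 'a) \<Rightarrow> bool" where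
  "IFS I f \<longleftrightarrow> finite I \<and> I \<noteq> {} \<and>
     (\<forall>i\<in>I. continuous_on UNIV (f i) \<and> (\<forall>B\<in>Pb. f i ` B \<in> Pb))"

definition fractal_op :: "'i set \<Rightarrow> ('i \<Rightarrow> 'a::metric_space \<Rightarrow> 'a) \<Rightarrow> 'a set \<Rightarrow> 'a set" where
  "fractal_op I f B = closure (\<Union>i\<in>I. f i ` B)"

definition words :: "'i set \<Rightarrow> nat \<Rightarrow> 'i list set" where
  "words I n = {w. set w \<subseteq> I \<and> length w = n}"

text \<open>\<open>word_map f [i\<^sub>1, \<dots>, i\<^sub>n] = f i\<^sub>1 \<circ> \<dots> \<circ> f i\<^sub>n\<close>, extended by the identity to
  the empty word. Infinite words are streams, so that the prefix of length \<open>n\<close> of \<open>\<omega>\<close> is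
  \<open>stake n \<omega>\<close> and the periodic word obtained by repeating \<open>w \<noteq> []\<close> is \<open>cycle w\<close>.\<close>

primrec word_map :: "('i \<Rightarrow> 'a \<Rightarrow> 'a) \<Rightarrow> 'i list \<Rightarrow> 'a \<Rightarrow> 'a" where
  "word_map f [] = id"
| "word_map f (i # w) = f i \<circ> word_map f w"

definition diameter_diminishing :: "'i set \<Rightarrow> ('i \<Rightarrow> 'a::metric_space \<Rightarrow> 'a) \<Rightarrow> bool" where
  "diameter_diminishing I f \<longleftrightarrow>
     (\<forall>B\<in>Pbcl. \<exists>M\<in>Pbcl. B \<subseteq> M \<and> fractal_op I f M \<subseteq> M \<and>
        (\<lambda>n. MAX w\<in>words I n. diameter (word_map f w ` M)) \<longlonglongrightarrow> 0)"

definition word_point :: "'i set \<Rightarrow> ('i \<Rightarrow> 'a::metric_space \<Rightarrow> 'a) \<Rightarrow> 'i stream \<Rightarrow> 'a" where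
  "word_point I f \<omega> =
     (THE a. \<forall>B\<in>Pbcl. fractal_op I f B \<subseteq> B \<longrightarrow>
        (\<Inter>n\<in>{1..}. closure (word_map f (stake n \<omega>) ` B)) = {a})"

definition is_attractor :: "'i set \<Rightarrow> ('i \<Rightarrow> 'a::metric_space \<Rightarrow> 'a) \<Rightarrow> 'a set \<Rightarrow> bool" where
  "is_attractor I f A \<longleftrightarrow> A \<in> Pbcl \<and> fractal_op I f A = A \<and>
     (\<forall>B\<in>Pbcl. (\<lambda>n. hausdorff_dist ((fractal_op I f ^^ n) B) A) \<longlonglongrightarrow> 0)"

definition attractor :: "'i set \<Rightarrow> ('i \<Rightarrow> 'a::metric_space \<Rightarrow> 'a) \<Rightarrow> 'a set" where
  "attractor I f = (THE A. is_attractor I f A)"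

end

theory Submission
  imports Defs
begin

text \<open>Both sides of the equation are the closure of the set of all points \<open>a\<^sub>\<omega>\<close>
  (\<open>word_point I f \<omega>\<close>), where \<open>\<omega>\<close> runs through all infinite words over \<open>I\<close>.

  Fix a nonempty bounded closed set \<open>M\<close> with \<open>F(M) \<subseteq> M\<close>. The images of \<open>M\<close> under the prefixes
  of an infinite word decrease, and their diameters tend to \<open>0\<close>, uniformly over all words of a given
  length. Completeness and Cantor's intersection theorem therefore make \<open>a\<^sub>\<omega>\<close> well defined, and
  everything else follows from the single principle that \<open>a\<^sub>\<omega>\<close> belongs to
  the closure of \<open>f\<^bsub>[\<omega>]\<^sub>n\<^esub>(M)\<close> for every \<open>n\<close>
  (\<open>word_point_in_closure\<close>), so that it is close to every other point of that small set.

  \<^item> The periodic word that repeats \<open>[\<omega>]\<^sub>n\<close> has the same prefix of length \<open>n\<close> as \<open>\<omega>\<close>, so its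
    point is close to \<open>a\<^sub>\<omega>\<close>: the points of periodic words are dense among all
    points \<open>a\<^sub>\<omega>\<close> (\<open>closure_periodic_points\<close>).

  \<^item> Prefixing a letter gives \<open>f\<^sub>i(a\<^sub>\<omega>) = a\<^bsub>i\<omega>\<^esub>\<close> (\<open>map_word_point\<close>), so the closure of the set
    of all \<open>a\<^sub>\<omega>\<close> is a fixed point of the fractal operator.

  \<^item> For \<open>B \<subseteq> M\<close>, the \<open>n\<close>-th iterate of \<open>B\<close> is the closure of the union of the sets \<open>f\<^sub>w(B)\<close> over
    the words \<open>w\<close> of length \<open>n\<close>. Each of these small sets lies close to the points \<open>a\<^sub>\<omega>\<close> with
    \<open>[\<omega>]\<^sub>n = w\<close>, and such \<open>\<omega>\<close> exist. So the iterates converge in the Hausdorff distance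
    (\<open>hausdorff_iterates_le\<close>).

  The last two items say that the closure of all \<open>a\<^sub>\<omega>\<close> is an attractor; attractors are unique because
  a fixed point of the fractal operator equals the limit of its own iterates.\<close>

section \<open>Words and the fractal operator\<close>

definition invariant_set :: "'i set \<Rightarrow> ('i \<Rightarrow> 'a::metric_space \<Rightarrow> 'a) \<Rightarrow> 'a set \<Rightarrow> bool" where
  "invariant_set I f B \<longleftrightarrow> B \<in> Pbcl \<and> fractal_op I f B \<subseteq> B"

text \<open>The image of the code space under the canonical projection \<open>\<omega> \<mapsto> a\<^sub>\<omega>\<close>.\<close>

definition coded_points :: "'i set \<Rightarrow> ('i \<Rightarrow> 'a::metric_space \<Rightarrow> 'a) \<Rightarrow> 'a set" where
  "coded_points I f = word_point I f ` streams I"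

lemma word_map_append: "word_map f (u @ v) = word_map f u \<circ> word_map f v"
  by (induction u) auto

lemma fractal_op_subset_iff:
  assumes "closed C"
  shows "fractal_op I f B \<subseteq> C \<longleftrightarrow> (\<forall>i\<in>I. f i ` B \<subseteq> C)"
proof -
  have "closure S \<subseteq> C \<longleftrightarrow> S \<subseteq> C" for S
    using closure_minimal[OF _ assms] closure_subset by blast
  then show ?thesis
    by (simp add: fractal_op_def UN_subset_iff)
qed

lemma finite_words: "finite I \<Longrightarrow> finite (words I n)"
  unfolding words_def by (rule finite_lists_length_eq)

lemma words_Suc: "words I (Suc n) = (\<Union>i\<in>I. (#) i ` words I n)"
  by (auto simp: words_def length_Suc_conv)

lemma stake_in_words: "\<omega> \<in> streams I \<Longrightarrow> stake n \<omega> \<in> words I n"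
  by (induction n arbitrary: \<omega>) (auto simp: words_def streams_shd streams_stl)

lemma sdrop_in_streams: "\<omega> \<in> streams I \<Longrightarrow> sdrop n \<omega> \<in> streams I"
  by (induction n arbitrary: \<omega>) (auto simp: streams_stl)

lemma cycle_in_streams: "w \<in> words I n \<Longrightarrow> w \<noteq> [] \<Longrightarrow> cycle w \<in> streams I"
  by (auto simp: words_def streams_iff_sset sset_cycle)

lemma invariant_set_props:
  assumes "invariant_set I f B"
  shows "B \<noteq> {}" "bounded B" "closed B"
  using assms by (auto simp: invariant_set_def Pbcl_def)

lemma word_map_image_invariant:
  assumes "invariant_set I f B" "set w \<subseteq> I"
  shows "word_map f w ` B \<subseteq> B"
  using assms(2)
proof (induction w)
  case (Cons i w)
  have "f i ` B \<subseteq> B"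
    using assms(1) Cons.prems fractal_op_subset_iff[of B I f B]
    by (auto simp: invariant_set_def Pbcl_def)
  with Cons show ?case by fastforce
qed simp

lemma stake_images_antimono:
  assumes "invariant_set I f B" "\<omega> \<in> streams I" "m \<le> n"
  shows "word_map f (stake n \<omega>) ` B \<subseteq> word_map f (stake m \<omega>) ` B"
proof -
  have "stake n \<omega> = stake m \<omega> @ stake (n - m) (sdrop m \<omega>)"
    using assms(3) by (simp add: stake_add)
  moreover have "set (stake (n - m) (sdrop m \<omega>)) \<subseteq> I"
    using stake_in_words[OF sdrop_in_streams[OF assms(2)]] by (simp add: words_def)
  ultimately show ?thesis
    using image_mono[OF word_map_image_invariant[OF assms(1)], of _ "word_map f (stake m \<omega>)"]
    by (metis word_map_append image_comp)
qed

text \<open>Any two invariant sets lie in a common one. This is what makes \<open>a\<^sub>\<omega>\<close> independent of the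
  invariant set from which it is computed.\<close>

lemma invariant_set_Un:
  assumes "invariant_set I f B" "invariant_set I f C"
  shows "invariant_set I f (B \<union> C)"
proof -
  have "fractal_op I f (B \<union> C) = closure ((\<Union>i\<in>I. f i ` B) \<union> (\<Union>i\<in>I. f i ` C))"
    unfolding fractal_op_def by (rule arg_cong[of _ _ closure]) blast
  then have "fractal_op I f (B \<union> C) = fractal_op I f B \<union> fractal_op I f C"
    by (simp add: fractal_op_def closure_Un)
  with assms show ?thesis
    unfolding invariant_set_def Pbcl_def by auto
qed

text \<open>Continuity lets the closures taken at the individual steps of an iteration be postponed to
  the end.\<close>

lemma fractal_op_closure:
  assumes "\<And>i. i \<in> I \<Longrightarrow> continuous_on UNIV (f i)"
  shows "fractal_op I f (closure S) = fractal_op I f S"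
proof
  have "f i ` closure S \<subseteq> fractal_op I f S" if "i \<in> I" for i
  proof (rule image_closure_subset)
    show "continuous_on (closure S) (f i)"
      using assms[OF that] continuous_on_subset by blast
    show "f i ` S \<subseteq> fractal_op I f S"
      using that closure_subset by (fastforce simp: fractal_op_def)
  qed (simp add: fractal_op_def)
  then show "fractal_op I f (closure S) \<subseteq> fractal_op I f S"
    by (simp add: fractal_op_subset_iff fractal_op_def[of I f S])
  show "fractal_op I f S \<subseteq> fractal_op I f (closure S)"
    unfolding fractal_op_def using closure_subset[of S]
    by (intro closure_mono) blast
qed

lemma fractal_op_funpow:
  assumes "\<And>i. i \<in> I \<Longrightarrow> continuous_on UNIV (f i)" "closed B"
  shows "(fractal_op I f ^^ n) B = closure (\<Union>w\<in>words I n. word_map f w ` B)"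
proof (induction n)
  case 0
  have "words I 0 = {[]}" by (auto simp: words_def)
  then show ?case using assms(2) by simp
next
  case (Suc n)
  have "(\<Union>i\<in>I. f i ` (\<Union>w\<in>words I n. word_map f w ` B))
      = (\<Union>w\<in>words I (Suc n). word_map f w ` B)"
    by (auto simp: words_Suc)
  moreover have "(fractal_op I f ^^ Suc n) B = fractal_op I f (\<Union>w\<in>words I n. word_map f w ` B)"
    using Suc fractal_op_closure[OF assms(1)] by simp
  ultimately show ?case
    by (simp only: fractal_op_def[of I f "\<Union>w\<in>words I n. word_map f w ` B"])
qed

section \<open>The Hausdorff distance and uniqueness of attractors\<close>

lemma hausdorff_dist_leI:
  assumes "A \<noteq> {}" "B \<noteq> {}"
    and "\<And>x. x \<in> A \<Longrightarrow> infdist x B \<le> e" "\<And>x. x \<in> B \<Longrightarrow> infdist x A \<le> e"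
  shows "hausdorff_dist A B \<le> e"
  unfolding hausdorff_dist_def using assms by (auto intro!: cSUP_least)

text \<open>A real supremum carries information only over a set that is bounded above; this bound is what
  allows conclusions to be drawn from the value of the Hausdorff distance.\<close>

lemma bdd_above_infdist:
  assumes "bounded A" "B \<noteq> {}"
  shows "bdd_above ((\<lambda>x. infdist x B) ` A)"
proof -
  obtain b where b: "b \<in> B" using assms(2) by blast
  obtain e where "\<forall>x\<in>A. dist b x \<le> e"
    using assms(1) bounded_any_center[of A b] by blast
  with b show ?thesis
    by (intro bdd_aboveI2[of _ _ e]) (metis dist_commute infdist_le2)
qed

lemma infdist_le_hausdorff_dist:
  assumes "A \<in> Pbcl" "B \<in> Pbcl"
  shows "x \<in> A \<Longrightarrow> infdist x B \<le> hausdorff_dist A B"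
    and "x \<in> B \<Longrightarrow> infdist x A \<le> hausdorff_dist A B"
proof -
  have AB: "bounded A" "bounded B" "A \<noteq> {}" "B \<noteq> {}"
    using assms by (auto simp: Pbcl_def)
  show "infdist x B \<le> hausdorff_dist A B" if "x \<in> A"
    using cSUP_upper[OF that bdd_above_infdist[OF AB(1,4)]]
    by (simp add: hausdorff_dist_def le_max_iff_disj)
  show "infdist x A \<le> hausdorff_dist A B" if "x \<in> B"
    using cSUP_upper[OF that bdd_above_infdist[OF AB(2,3)]]
    by (simp add: hausdorff_dist_def le_max_iff_disj)
qed

lemma hausdorff_dist_nonneg:
  assumes "A \<in> Pbcl" "B \<in> Pbcl"
  shows "0 \<le> hausdorff_dist A B"
proof -
  obtain x where "x \<in> A" using assms by (auto simp: Pbcl_def)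
  then show ?thesis
    using infdist_le_hausdorff_dist(1)[OF assms] infdist_nonneg[of x B] by force
qed

lemma hausdorff_dist_eq_0D:
  assumes "A \<in> Pbcl" "B \<in> Pbcl" "hausdorff_dist A B = 0"
  shows "A = B"
proof -
  have "infdist x B = 0" if "x \<in> A" for x
    using infdist_le_hausdorff_dist(1)[OF assms(1,2) that] assms(3) infdist_nonneg[of x B] by simp
  moreover have "infdist x A = 0" if "x \<in> B" for x
    using infdist_le_hausdorff_dist(2)[OF assms(1,2) that] assms(3) infdist_nonneg[of x A] by simp
  moreover have "closed A" "A \<noteq> {}" "closed B" "B \<noteq> {}"
    using assms(1,2) by (auto simp: Pbcl_def)
  ultimately show ?thesis
    using in_closed_iff_infdist_zero by blast
qed

text \<open>The iterates of the fixed set \<open>A\<close> form a constant sequence, which also has to converge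
  to \<open>B\<close>.\<close>

lemma is_attractor_unique:
  assumes "is_attractor I f A" "is_attractor I f B"
  shows "A = B"
proof -
  have "(fractal_op I f ^^ n) A = A" for n
    using assms(1) by (induction n) (auto simp: is_attractor_def)
  then have "(\<lambda>n::nat. hausdorff_dist A B) \<longlonglongrightarrow> 0"
    using assms by (auto simp: is_attractor_def)
  then have "hausdorff_dist A B = 0"
    by (simp add: LIMSEQ_const_iff)
  then show ?thesis
    using assms hausdorff_dist_eq_0D by (auto simp: is_attractor_def)
qed

lemma infdist_le_on_closure:
  assumes "\<And>x. x \<in> S \<Longrightarrow> infdist x T \<le> e" "x \<in> closure S"
  shows "infdist x T \<le> e"
proof -
  have "closed {x. infdist x T \<le> e}"
    by (intro closed_Collect_le continuous_intros)
  then have "closure S \<subseteq> {x. infdist x T \<le> e}"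
    using assms(1) by (intro closure_minimal) auto
  with assms(2) show ?thesis by blast
qed

section \<open>The points of infinite words\<close>

text \<open>Uniform decay of the diameters of the images \<open>f\<^sub>w(M)\<close>, expressed by distances of pairs of
  points: in this form it applies directly to points of the closures, which is where the
  points \<open>a\<^sub>\<omega>\<close> are found.\<close>

definition images_shrink :: "'i set \<Rightarrow> ('i \<Rightarrow> 'a::metric_space \<Rightarrow> 'a) \<Rightarrow> 'a set \<Rightarrow> bool" where
  "images_shrink I f M \<longleftrightarrow> (\<forall>e>0. \<exists>N. \<forall>n\<ge>N. \<forall>w\<in>words I n.
     \<forall>x\<in>closure (word_map f w ` M). \<forall>y\<in>closure (word_map f w ` M). dist x y < e)"

lemma images_shrinkE:
  assumes "images_shrink I f M" "e > 0"
  obtains N where "\<And>n w x y. n \<ge> N \<Longrightarrow> w \<in> words I n \<Longrightarrow> x \<in> closure (word_map f w ` M)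
      \<Longrightarrow> y \<in> closure (word_map f w ` M) \<Longrightarrow> dist x y < e"
  using assms unfolding images_shrink_def by meson

lemma images_shrink_mono:
  assumes "images_shrink I f M" "B \<subseteq> M"
  shows "images_shrink I f B"
proof -
  have "closure (word_map f w ` B) \<subseteq> closure (word_map f w ` M)" for w
    using assms(2) by (intro closure_mono image_mono)
  then show ?thesis
    using assms(1) unfolding images_shrink_def by (meson subsetD)
qed

locale diminishing_IFS =
  fixes I :: "'i set" and f :: "'i \<Rightarrow> 'a::complete_space \<Rightarrow> 'a"
  assumes IFS: "IFS I f" and diminishing: "diameter_diminishing I f"
begin

lemma finite_I: "finite I" and I_nonempty: "I \<noteq> {}"
  and continuous_f: "i \<in> I \<Longrightarrow> continuous_on UNIV (f i)"
  using IFS by (auto simp: IFS_def)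

lemma invariant_superset:
  assumes "B \<in> Pbcl"
  obtains M where "invariant_set I f M" "B \<subseteq> M" "images_shrink I f M"
proof -
  obtain M where M: "M \<in> Pbcl" "B \<subseteq> M" "fractal_op I f M \<subseteq> M"
    and lim: "(\<lambda>n. MAX w\<in>words I n. diameter (word_map f w ` M)) \<longlonglongrightarrow> 0"
    using diminishing assms unfolding diameter_diminishing_def by blast
  then have inv: "invariant_set I f M" by (simp add: invariant_set_def)
  have "images_shrink I f M"
    unfolding images_shrink_def
  proof (intro allI impI)
    fix e :: real assume "e > 0"
    then obtain N where N: "\<And>n. n \<ge> N \<Longrightarrow> (MAX w\<in>words I n. diameter (word_map f w ` M)) < e"
      using order_tendstoD(2)[OF lim] by (auto simp: eventually_sequentially)
    have "dist x y < e"
      if "n \<ge> N" and w: "w \<in> words I n"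
        and xy: "x \<in> closure (word_map f w ` M)" "y \<in> closure (word_map f w ` M)" for n w x y
    proof -
      have "word_map f w ` M \<subseteq> M"
        using w word_map_image_invariant[OF inv] by (simp add: words_def)
      then have bdd: "bounded (word_map f w ` M)"
        using invariant_set_props(2)[OF inv] bounded_subset by blast
      then have "dist x y \<le> diameter (word_map f w ` M)"
        using diameter_bounded_bound[OF bounded_closure xy] by (simp add: diameter_closure)
      also have "\<dots> \<le> (MAX w\<in>words I n. diameter (word_map f w ` M))"
        using w finite_words[OF finite_I] by (intro Max_ge) auto
      also have "\<dots> < e" using N that by blast
      finally show ?thesis .
    qed
    then show "\<exists>N. \<forall>n\<ge>N. \<forall>w\<in>words I n. \<forall>x\<in>closure (word_map f w ` M).
        \<forall>y\<in>closure (word_map f w ` M). dist x y < e"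
      by blast
  qed
  with inv M that show thesis by blast
qed

text \<open>The hypothesis provides decay for one invariant superset of \<open>B\<close>; the images of \<open>B\<close> are
  contained in the images of that superset.\<close>

lemma invariant_images_shrink:
  assumes "invariant_set I f B"
  shows "images_shrink I f B"
proof -
  have "B \<in> Pbcl" using assms by (simp add: invariant_set_def)
  then obtain M where "B \<subseteq> M" "images_shrink I f M"
    using invariant_superset by metis
  then show ?thesis using images_shrink_mono by blast
qed

lemma exists_invariant_set: obtains M where "invariant_set I f M"
  using invariant_superset[of "{undefined}"] by (auto simp: Pbcl_def)

text \<open>Cantor's intersection theorem for the decreasing sets given by the prefixes of \<open>\<omega>\<close>.\<close>

lemma nested_intersection_singleton:
  assumes "invariant_set I f B" "\<omega> \<in> streams I"
  shows "\<exists>a. (\<Inter>n\<in>{1..}. closure (word_map f (stake n \<omega>) ` B)) = {a}"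
proof -
  \<comment> \<open>The index is shifted because the intersection starts at prefixes of length \<open>1\<close>.\<close>
  let ?S = "\<lambda>n. closure (word_map f (stake (Suc n) \<omega>) ` B)"
  have "\<exists>a. \<Inter> (range ?S) = {a}"
  proof (rule decreasing_closed_nest_sing)
    show "?S n \<subseteq> ?S m" if "m \<le> n" for m n
      using stake_images_antimono[OF assms, of "Suc m" "Suc n"] that closure_mono by blast
    show "\<exists>n. \<forall>x\<in>?S n. \<forall>y\<in>?S n. dist x y < e" if "e > 0" for e
    proof -
      obtain N where N: "\<And>n w x y. n \<ge> N \<Longrightarrow> w \<in> words I n \<Longrightarrow> x \<in> closure (word_map f w ` B)
          \<Longrightarrow> y \<in> closure (word_map f w ` B) \<Longrightarrow> dist x y < e"
        by (rule images_shrinkE[OF invariant_images_shrink[OF assms(1)] \<open>e > 0\<close>]) blast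
      then have "\<forall>x\<in>?S N. \<forall>y\<in>?S N. dist x y < e"
        using stake_in_words[OF assms(2), of "Suc N"] by (meson le_SucI order_refl)
      then show ?thesis ..
    qed
  qed (use invariant_set_props(1)[OF assms(1)] in auto)
  moreover have "range ?S = (\<lambda>n. closure (word_map f (stake n \<omega>) ` B)) ` {1..}"
  proof -
    have "{1..} = range Suc"
      by (auto simp: image_iff Suc_le_eq gr0_conv_Suc)
    then show ?thesis by (simp add: image_image)
  qed
  ultimately show ?thesis by simp
qed

text \<open>The intersection for \<open>B \<union> C\<close> is a singleton that contains both the intersection for \<open>B\<close> and
  that for \<open>C\<close>, so all three agree. Hence the point does not depend on the invariant set, and the
  definite description denotes it.\<close>

lemma word_point_characterization:
  assumes "invariant_set I f B" "\<omega> \<in> streams I"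
  shows "(\<Inter>n\<in>{1..}. closure (word_map f (stake n \<omega>) ` B)) = {word_point I f \<omega>}"
proof -
  let ?J = "\<lambda>B. \<Inter>n\<in>{1..}. closure (word_map f (stake n \<omega>) ` B)"
  obtain a where a: "?J B = {a}"
    using nested_intersection_singleton[OF assms] by blast
  have all: "?J C = {a}" if C: "invariant_set I f C" for C
  proof -
    obtain c where c: "?J C = {c}"
      using nested_intersection_singleton[OF C assms(2)] by blast
    obtain b where b: "?J (B \<union> C) = {b}"
      using nested_intersection_singleton[OF invariant_set_Un[OF assms(1) C] assms(2)] by blast
    have "?J B \<subseteq> ?J (B \<union> C)" "?J C \<subseteq> ?J (B \<union> C)"
      by (intro INF_mono' closure_mono image_mono; blast)+
    with a b c show ?thesis by simp
  qed
  have "word_point I f \<omega> = a"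
    unfolding word_point_def
  proof (rule the_equality)
    show "\<forall>B\<in>Pbcl. fractal_op I f B \<subseteq> B \<longrightarrow> ?J B = {a}"
      using all by (simp add: invariant_set_def)
    show "b = a" if "\<forall>B\<in>Pbcl. fractal_op I f B \<subseteq> B \<longrightarrow> ?J B = {b}" for b
      using that a assms(1) by (auto simp: invariant_set_def)
  qed
  with a show ?thesis by simp
qed

lemma word_point_in_closure:
  assumes "invariant_set I f B" "\<omega> \<in> streams I"
  shows "word_point I f \<omega> \<in> closure (word_map f (stake n \<omega>) ` B)"
proof -
  have *: "word_point I f \<omega> \<in> closure (word_map f (stake (Suc n) \<omega>) ` B)"
    using word_point_characterization[OF assms] by fastforce
  show ?thesis
    using * closure_mono[OF stake_images_antimono[OF assms, of n "Suc n"]] by auto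
qed

lemma word_point_in_invariant_set:
  assumes "invariant_set I f B" "\<omega> \<in> streams I"
  shows "word_point I f \<omega> \<in> B"
  using word_point_in_closure[OF assms, of 0] invariant_set_props(3)[OF assms(1)] by simp

text \<open>By continuity \<open>f\<^sub>i\<close> maps the closures that determine \<open>a\<^sub>\<omega>\<close> into those that
  determine \<open>a\<^bsub>i\<omega>\<^esub>\<close>.\<close>

lemma map_word_point:
  assumes "i \<in> I" "\<omega> \<in> streams I"
  shows "f i (word_point I f \<omega>) = word_point I f (i ## \<omega>)"
proof -
  obtain B where B: "invariant_set I f B" by (rule exists_invariant_set)
  have "f i (word_point I f \<omega>) \<in> closure (word_map f (stake n (i ## \<omega>)) ` B)" if "n \<in> {1..}" for n
  proof -
    obtain m where n: "n = Suc m"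
      using \<open>n \<in> {1..}\<close> not0_implies_Suc[of n] by fastforce
    have "f i ` closure (word_map f (stake m \<omega>) ` B) \<subseteq> closure (f i ` word_map f (stake m \<omega>) ` B)"
      using continuous_on_subset[OF continuous_f[OF assms(1)]]
      by (intro image_closure_subset closure_subset) auto
    then show ?thesis
      using word_point_in_closure[OF B assms(2), of m] by (auto simp: n image_comp)
  qed
  then show ?thesis
    using word_point_characterization[OF B, of "i ## \<omega>"] assms by (auto simp: streams_Stream)
qed

section \<open>The attractor as the closure of the coded points\<close>

text \<open>The maps \<open>f\<^sub>i\<close> act on coded points by prefixing a letter, and every infinite word is its first
  letter followed by its tail; so the coded points are exactly the union of their images.\<close>

lemma fractal_op_coded_points:
  "fractal_op I f (closure (coded_points I f)) = closure (coded_points I f)"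
proof -
  have "(\<Union>i\<in>I. f i ` coded_points I f) = coded_points I f"
  proof
    show "(\<Union>i\<in>I. f i ` coded_points I f) \<subseteq> coded_points I f"
      by (auto simp: coded_points_def map_word_point streams_Stream)
    show "coded_points I f \<subseteq> (\<Union>i\<in>I. f i ` coded_points I f)"
    proof
      fix x assume "x \<in> coded_points I f"
      then obtain \<omega> where \<omega>: "\<omega> \<in> streams I" "x = word_point I f \<omega>"
        by (auto simp: coded_points_def)
      then have "x = f (shd \<omega>) (word_point I f (stl \<omega>))"
        by (simp add: map_word_point streams_shd streams_stl)
      moreover have "shd \<omega> \<in> I" "word_point I f (stl \<omega>) \<in> coded_points I f"
        using \<omega>(1) by (auto simp: coded_points_def streams_shd streams_stl)
      ultimately show "x \<in> (\<Union>i\<in>I. f i ` coded_points I f)"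
        by blast
    qed
  qed
  moreover have "fractal_op I f (closure (coded_points I f)) = fractal_op I f (coded_points I f)"
    by (intro fractal_op_closure continuous_f)
  ultimately show ?thesis
    by (simp only: fractal_op_def[of I f "coded_points I f"])
qed

lemma word_has_extension:
  assumes "w \<in> words I n"
  obtains \<omega> where "\<omega> \<in> streams I" "stake n \<omega> = w"
proof -
  obtain i where "i \<in> I" using I_nonempty by blast
  then have "w @- sconst i \<in> streams I"
    using assms by (auto simp: words_def streams_iff_sset)
  moreover have "stake n (w @- sconst i) = w"
    using assms by (auto simp: words_def stake_shift)
  ultimately show thesis using that by blast
qed

lemma coded_points_nonempty: "coded_points I f \<noteq> {}"
proof -
  obtain \<omega> where "\<omega> \<in> streams I"
    using word_has_extension[of "[]" 0] by (auto simp: words_def)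
  then show ?thesis by (auto simp: coded_points_def)
qed

lemma closure_coded_points_Pbcl: "closure (coded_points I f) \<in> Pbcl"
proof -
  obtain B where B: "invariant_set I f B" by (rule exists_invariant_set)
  have "coded_points I f \<subseteq> B"
    using word_point_in_invariant_set[OF B] by (auto simp: coded_points_def)
  then have "bounded (coded_points I f)"
    using invariant_set_props(2)[OF B] bounded_subset by blast
  with coded_points_nonempty show ?thesis by (auto simp: Pbcl_def)
qed

lemma funpow_Pbcl:
  assumes "B \<in> Pbcl"
  shows "(fractal_op I f ^^ n) B \<in> Pbcl"
proof (induction n)
  case (Suc n)
  then have "(fractal_op I f ^^ n) B \<in> Pb" (is "?C \<in> Pb")
    by (simp add: Pbcl_def Pb_def)
  then have "\<forall>i\<in>I. f i ` ?C \<in> Pb" using IFS by (simp add: IFS_def)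
  then have "(\<Union>i\<in>I. f i ` ?C) \<noteq> {}" "bounded (\<Union>i\<in>I. f i ` ?C)"
    using finite_I I_nonempty by (auto simp: Pb_def)
  then have "fractal_op I f ?C \<in> Pbcl"
    using bounded_closure by (simp only: fractal_op_def Pbcl_def) simp
  then show ?case by simp
qed (use assms in simp)

text \<open>A point \<open>f\<^sub>w(b)\<close> of the \<open>n\<close>-th iterate and the point \<open>a\<^sub>\<omega>\<close> of a word with prefix \<open>w\<close> both lie in
  the closure of \<open>f\<^sub>w(M)\<close>. Extending \<open>w\<close> to an infinite word bounds the distance in one direction,
  truncating \<open>\<omega>\<close> to its prefix of length \<open>n\<close> bounds it in the other.\<close>

lemma hausdorff_iterates_le:
  assumes "B \<in> Pbcl" "e > 0"
  shows "\<exists>N. \<forall>n\<ge>N. hausdorff_dist ((fractal_op I f ^^ n) B) (closure (coded_points I f)) \<le> e"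
proof -
  obtain M where M: "invariant_set I f M" "B \<subseteq> M" and small: "images_shrink I f M"
    using invariant_superset[OF assms(1)] by metis
  obtain N where N: "\<And>n w x y. n \<ge> N \<Longrightarrow> w \<in> words I n \<Longrightarrow> x \<in> closure (word_map f w ` M)
      \<Longrightarrow> y \<in> closure (word_map f w ` M) \<Longrightarrow> dist x y < e"
    by (rule images_shrinkE[OF small assms(2)]) blast
  have "hausdorff_dist ((fractal_op I f ^^ n) B) (closure (coded_points I f)) \<le> e"
    if n: "n \<ge> N" for n
  proof -
    let ?U = "\<Union>w\<in>words I n. word_map f w ` B"
    have F: "(fractal_op I f ^^ n) B = closure ?U"
      using assms(1) by (intro fractal_op_funpow continuous_f) (auto simp: Pbcl_def)
    have close: "dist (word_map f (stake n \<omega>) b) (word_point I f \<omega>) \<le> e"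
      if "\<omega> \<in> streams I" "b \<in> B" for \<omega> b
      using N[OF n stake_in_words[OF that(1)] _ word_point_in_closure[OF M(1) that(1)]]
        that(2) M(2) closure_subset by (meson image_eqI less_imp_le subsetD)
    have iterate_near: "infdist x (closure (coded_points I f)) \<le> e" if x: "x \<in> ?U" for x
    proof -
      obtain w b where w: "w \<in> words I n" "b \<in> B" "x = word_map f w b" using x by blast
      obtain \<omega> where "\<omega> \<in> streams I" "stake n \<omega> = w" using word_has_extension[OF w(1)] .
      moreover from this have "word_point I f \<omega> \<in> closure (coded_points I f)"
        by (intro subsetD[OF closure_subset]) (simp add: coded_points_def)
      ultimately show ?thesis
        using close[of \<omega> b] w by (intro infdist_le2[of "word_point I f \<omega>"]) auto
    qed
    have coded_near: "infdist x (closure ?U) \<le> e" if x: "x \<in> coded_points I f" for x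
    proof -
      obtain \<omega> where \<omega>: "\<omega> \<in> streams I" "x = word_point I f \<omega>"
        using x by (auto simp: coded_points_def)
      obtain b where b: "b \<in> B" using assms(1) by (auto simp: Pbcl_def)
      have "word_map f (stake n \<omega>) b \<in> ?U"
        using b stake_in_words[OF \<omega>(1)] by blast
      then have "word_map f (stake n \<omega>) b \<in> closure ?U"
        by (rule subsetD[OF closure_subset])
      then show ?thesis
        using close[OF \<omega>(1) b] \<omega>(2) by (intro infdist_le2) (auto simp: dist_commute)
    qed
    show ?thesis
      unfolding F
    proof (rule hausdorff_dist_leI)
      show "closure ?U \<noteq> {}"
        using funpow_Pbcl[OF assms(1), of n] unfolding F Pbcl_def by blast
      show "closure (coded_points I f) \<noteq> {}"
        using coded_points_nonempty by simp
    qed (use infdist_le_on_closure[OF iterate_near] infdist_le_on_closure[OF coded_near] in blast)+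
  qed
  then show ?thesis by blast
qed

lemma is_attractor_coded_points: "is_attractor I f (closure (coded_points I f))"
proof -
  have "(\<lambda>n. hausdorff_dist ((fractal_op I f ^^ n) B) (closure (coded_points I f))) \<longlonglongrightarrow> 0"
    if B: "B \<in> Pbcl" for B
  proof (rule LIMSEQ_I)
    fix r :: real assume "0 < r"
    then obtain N where "\<forall>n\<ge>N. hausdorff_dist ((fractal_op I f ^^ n) B) (closure (coded_points I f)) \<le> r / 2"
      using hausdorff_iterates_le[OF B, of "r / 2"] by auto
    then show "\<exists>N. \<forall>n\<ge>N. norm (hausdorff_dist ((fractal_op I f ^^ n) B) (closure (coded_points I f)) - 0) < r"
      using hausdorff_dist_nonneg[OF funpow_Pbcl[OF B] closure_coded_points_Pbcl] \<open>0 < r\<close>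
      by (intro exI[of _ N]) (force simp: abs_of_nonneg)
  qed
  then show ?thesis
    using closure_coded_points_Pbcl fractal_op_coded_points by (simp add: is_attractor_def)
qed

lemma attractor_eq_closure_coded_points: "attractor I f = closure (coded_points I f)"
  unfolding attractor_def
  by (rule the_equality) (rule is_attractor_coded_points,
      rule is_attractor_unique[OF _ is_attractor_coded_points])

section \<open>Density of the points of periodic words\<close>

text \<open>Repeating a long prefix of \<open>\<omega>\<close> yields a periodic word that agrees with \<open>\<omega>\<close> on that prefix, so
  both points lie in the closure of the same small image.\<close>

lemma coded_point_periodic_approx:
  assumes "\<omega> \<in> streams I" "e > 0"
  obtains w n where "w \<in> words I n" "w \<noteq> []" "dist (word_point I f (cycle w)) (word_point I f \<omega>) < e"
proof -
  obtain M where M: "invariant_set I f M" by (rule exists_invariant_set)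
  obtain N where N: "\<And>n w x y. n \<ge> N \<Longrightarrow> w \<in> words I n \<Longrightarrow> x \<in> closure (word_map f w ` M)
      \<Longrightarrow> y \<in> closure (word_map f w ` M) \<Longrightarrow> dist x y < e"
    by (rule images_shrinkE[OF invariant_images_shrink[OF M] assms(2)]) blast
  \<comment> \<open>Length \<open>N + 1\<close> rather than \<open>N\<close>: the word to be repeated must not be empty.\<close>
  let ?w = "stake (Suc N) \<omega>"
  have w: "?w \<in> words I (Suc N)" "?w \<noteq> []" using stake_in_words[OF assms(1), of "Suc N"] by auto
  have "stake (Suc N) (cycle ?w) = ?w"
    using stake_cycle_eq[OF w(2)] by (simp only: length_stake)
  then have "word_point I f (cycle ?w) \<in> closure (word_map f ?w ` M)"
    using word_point_in_closure[OF M cycle_in_streams[OF w], of "Suc N"] by (simp only:)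
  then have "dist (word_point I f (cycle ?w)) (word_point I f \<omega>) < e"
    by (rule N[OF _ w(1) _ word_point_in_closure[OF M assms(1)], rotated]) simp
  with w that show thesis by blast
qed

lemma closure_periodic_points:
  "closure {word_point I f (cycle w) | w. w \<in> (\<Union>n. words I n) - {[]}} = closure (coded_points I f)"
  (is "closure ?P = _")
proof
  show "closure ?P \<subseteq> closure (coded_points I f)"
    by (intro closure_mono) (auto simp: coded_points_def intro: cycle_in_streams)
  have "word_point I f \<omega> \<in> closure ?P" if \<omega>: "\<omega> \<in> streams I" for \<omega>
    unfolding closure_approachable
  proof (intro allI impI)
    fix e :: real assume "e > 0"
    then obtain w n where "w \<in> words I n" "w \<noteq> []"
        "dist (word_point I f (cycle w)) (word_point I f \<omega>) < e"
      by (rule coded_point_periodic_approx[OF \<omega>])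
    then show "\<exists>y\<in>?P. dist y (word_point I f \<omega>) < e" by blast
  qed
  then have "coded_points I f \<subseteq> closure ?P"
    by (auto simp: coded_points_def)
  then show "closure (coded_points I f) \<subseteq> closure ?P"
    by (simp add: closure_minimal)
qed

end

theorem proposition3p7:
  fixes I :: "'i set" and f :: "'i \<Rightarrow> 'a::complete_space \<Rightarrow> 'a"
  assumes "IFS I f" and "diameter_diminishing I f"
  shows "attractor I f = closure {word_point I f (cycle w) | w. w \<in> (\<Union>n. words I n) - {[]}}"
proof -
  interpret diminishing_IFS I f
    using assms by unfold_locales
  show ?thesis
    by (simp only: attractor_eq_closure_coded_points closure_periodic_points)
qed

end
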